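(* Let $G$ be a simple undirected graph and let $\mathbb{P}(G)$ be its path partial group. Then $$\operatorname{Aut}_{\mathrm{Part}}\big(\mathbb{P}(G)\big)\cong\operatorname{Aut}_{\mathrm{Graphs}}(G).$$
   Context: Graphs: $\mathrm{Graphs}$ is the category of simple undirected graphs $G=(V,E)$ (possibly infinite) and graph homomorphisms; $\operatorname{Aut}_{\mathrm{Graphs}}(G)$ is the group of graph automorphisms. A clique of $G$ is a (possibly infinite) subset $C\subseteq V$ of pairwise adjacent vertices. Partial groups: for a set $X$, $\mathbb{W}(X)$ is the free monoid of words on $X$, $\circ$ is concatenation, $\emptyset$ the empty word, and $X$ is identified with the words of length 1. A partial group is a tuple $\mathbb{M}=(\mathcal{M},\mathbb{D},\Pi,(-)^{-1})$ where $\mathcal{M}$ is a non-empty set; $\mathbb{D}\subseteq\mathbb{W}(\mathcal{M})$ satisfies $\mathcal{M}\subseteq\mathbb{D}$ and ($u\circ v\in\mathbb{D}\Rightarrow u,v\in\mathbb{D}$); $\Pi\colon\mathbb{D}\to\mathcal{M}$ restricts to the identity on $\mathcal{M}$ and if $u\circ v\circ w\in\mathbb{D}$ then $u\circ\Pi(v)\circ w\in\mathbb{D}$ and $\Pi(u\circ v\circ w)=\Pi(u\circ\Pi(v)\circ w)$; $x\mapsto x^{-1}$ is an involutory bijection of $\mathcal{M}$, extended to words by $(x_1,\dots,x_n)^{-1}=(x_n^{-1},\dots,x_1^{-1})$, such that if $u\in\mathbb{D}$ then $u^{-1}\circ u\in\mathbb{D}$ and $\Pi(u^{-1}\circ u)=1:=\Pi(\emptyset)$.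 A homomorphism of partial groups is a map $\varphi\colon\mathcal{M}_1\to\mathcal{M}_2$ whose letterwise extension $\overline{\varphi}$ satisfies $\overline{\varphi}(\mathbb{D}_1)\subseteq\mathbb{D}_2$ and $\Pi_2(\overline{\varphi}(u))=\varphi(\Pi_1(u))$ for $u\in\mathbb{D}_1$; isomorphisms are bijective homomorphisms whose inverse is a homomorphism. $\mathrm{Part}$ is the resulting category and $\operatorname{Aut}_{\mathrm{Part}}(\mathbb{M})$ the automorphism group of $\mathbb{M}$ in it. The partial group $\mathbb{M}(G,\mathcal{H})$: let $G=(V,E)$ be a simple undirected graph and $\mathcal{H}=\{H_v\}_{v\in V}$ a collection of groups. Put $H_v^*=H_v\smallsetminus\{1\}$ (regarded as disjoint sets for different $v$). A word $(g_1,\dots,g_r)\in\mathbb{W}(\bigcup_{v}H_v^* )$ is reduced if consecutive letters lie in different groups $H_v$ (the empty word is reduced), and cyclically reduced if all its cyclic permutations are reduced (the empty word and words of length 1 are cyclically reduced). $\Pi(w)$ denotes the unique reduced form of a word $w$, i.e. the element of the free product it represents. For a clique $C$ let $\mathbb{M}(C)=(\operatorname{CR}(C),\mathbb{D}(C),\Pi(C),(-)_C^{-1})$, where $\operatorname{CR}(C)$ is the set of cyclically reduced words in $\mathbb{W}(\bigcup_{v\in C}H_v^* )$; $\mathbb{D}(C)$ is the set of words $(u_1,\dots,u_n)\in\mathbb{W}(\operatorname{CR}(C))$ such that $\Pi(u_i\circ u_{i+1}\circ\cdots\circ u_j)\in\operatorname{CR}(C)$ for all $1\le i\le j\le n$;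 $\Pi(C)(u_1,\dots,u_n)=\Pi(u_1\circ\cdots\circ u_n)$; and $(-)_C^{-1}$ is inversion in the free product $\ast_{v\in C}H_v$. Each $\mathbb{M}(C)$ is a partial group, and $\mathbb{M}(G,\mathcal{H})=(\mathcal{M}(G,\mathcal{H}),\mathbb{D}(G,\mathcal{H}),\Pi(G,\mathcal{H}),(-)^{-1})$ is the colimit in $\mathrm{Part}$ of the $\mathbb{M}(C)$ over the poset of cliques $C$ of $G$ ordered by inclusion (with the inclusion maps). It is identified concretely with $\mathcal{M}(G,\mathcal{H})=\bigcup_C\operatorname{CR}(C)$, $\mathbb{D}(G,\mathcal{H})=\bigcup_C\mathbb{D}(C)$, with product and inversion those of the $\mathbb{M}(C)$. The path partial group of $G$ is $\mathbb{P}(G)=\mathbb{M}(G,\{\mathbb{Z}_2\}_{v\in V})$, i.e. each $H_v$ is a copy of the cyclic group $\mathbb{Z}_2$ of order 2. *)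

theory Defs
  imports "HOL-Algebra.Bij" "HOL-Algebra.Elementary_Groups" "Graph_Theory.Pair_Digraph"
begin

section \<open>Graphs and their automorphism groups\<close>

text \<open>
  A simple undirected (possibly infinite) graph is a \<^locale>\<open>pair_bidirected_digraph\<close>:
  the arcs form a symmetric, irreflexive relation on the vertex set, so that an edge
  between \<open>u\<close> and \<open>v\<close> is the pair of arcs \<open>(u, v)\<close>, \<open>(v, u)\<close>.
\<close>

definition graph_hom :: "'v pair_pre_digraph \<Rightarrow> 'w pair_pre_digraph \<Rightarrow> ('v \<Rightarrow> 'w) set" where
  "graph_hom G K = {f \<in> pverts G \<rightarrow> pverts K. \<forall>u v. (u, v) \<in> parcs G \<longrightarrow> (f u, f v) \<in> parcs K}"

definition graph_iso :: "'v pair_pre_digraph \<Rightarrow> 'w pair_pre_digraph \<Rightarrow> ('v \<Rightarrow> 'w) set" where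
  "graph_iso G K = {f \<in> graph_hom G K.
     bij_betw f (pverts G) (pverts K) \<and> inv_into (pverts G) f \<in> graph_hom K G}"

definition Aut_Graphs :: "'v pair_pre_digraph \<Rightarrow> ('v \<Rightarrow> 'v) monoid" where
  "Aut_Graphs G = BijGroup (pverts G) \<lparr>carrier := graph_iso G G \<inter> Bij (pverts G)\<rparr>"

definition clique :: "'v pair_pre_digraph \<Rightarrow> 'v set \<Rightarrow> bool" where
  "clique G C \<longleftrightarrow> C \<subseteq> pverts G \<and> (\<forall>u\<in>C. \<forall>v\<in>C. u \<noteq> v \<longrightarrow> (u, v) \<in> parcs G)"


section \<open>Partial groups\<close>

text \<open>
  Words are lists. \<open>pprod\<close> and \<open>pinv\<close> are total functions, of which only the restrictions to
  \<open>pdom\<close> and to the carrier are meaningful.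
\<close>

record 'a partial_group = "'a partial_object" +
  pdom :: "'a list set"
  pprod :: "'a list \<Rightarrow> 'a"
  pinv :: "'a \<Rightarrow> 'a"

locale partial_group =
  fixes M :: "('a, 'b) partial_group_scheme"
  assumes carrier_nonempty: "carrier M \<noteq> {}"
    and pdom_subset: "pdom M \<subseteq> lists (carrier M)"
    and singleton_pdom: "x \<in> carrier M \<Longrightarrow> [x] \<in> pdom M"
    and append_pdomD: "u @ v \<in> pdom M \<Longrightarrow> u \<in> pdom M \<and> v \<in> pdom M"
    and pprod_closed: "u \<in> pdom M \<Longrightarrow> pprod M u \<in> carrier M"
    and pprod_singleton: "x \<in> carrier M \<Longrightarrow> pprod M [x] = x"
    and pprod_pdom: "u @ v @ w \<in> pdom M \<Longrightarrow> u @ [pprod M v] @ w \<in> pdom M"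
    and pprod_assoc: "u @ v @ w \<in> pdom M \<Longrightarrow> pprod M (u @ v @ w) = pprod M (u @ [pprod M v] @ w)"
    and pinv_closed: "x \<in> carrier M \<Longrightarrow> pinv M x \<in> carrier M"
    and pinv_pinv: "x \<in> carrier M \<Longrightarrow> pinv M (pinv M x) = x"
    and pinv_pdom: "u \<in> pdom M \<Longrightarrow> rev (map (pinv M) u) @ u \<in> pdom M"
    and pprod_pinv: "u \<in> pdom M \<Longrightarrow> pprod M (rev (map (pinv M) u) @ u) = pprod M []"

definition part_hom ::
    "('a, 'm) partial_group_scheme \<Rightarrow> ('b, 'n) partial_group_scheme \<Rightarrow> ('a \<Rightarrow> 'b) set" where
  "part_hom M N = {\<phi> \<in> carrier M \<rightarrow> carrier N.
     \<forall>u\<in>pdom M. map \<phi> u \<in> pdom N \<and> pprod N (map \<phi> u) = \<phi> (pprod M u)}"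

definition part_iso ::
    "('a, 'm) partial_group_scheme \<Rightarrow> ('b, 'n) partial_group_scheme \<Rightarrow> ('a \<Rightarrow> 'b) set" where
  "part_iso M N = {\<phi> \<in> part_hom M N.
     bij_betw \<phi> (carrier M) (carrier N) \<and> inv_into (carrier M) \<phi> \<in> part_hom N M}"

definition Aut_Part :: "('a, 'm) partial_group_scheme \<Rightarrow> ('a \<Rightarrow> 'a) monoid" where
  "Aut_Part M = BijGroup (carrier M) \<lparr>carrier := part_iso M M \<inter> Bij (carrier M)\<rparr>"


section \<open>Words over a family of groups\<close>

text \<open>
  The element \<open>g\<close> of the group \<open>H v\<close> is written as the letter \<open>(v, g)\<close>, which makes the sets of
  letters for different \<open>v\<close> disjoint.
\<close>

definition letters :: "('v \<Rightarrow> 'a monoid) \<Rightarrow> 'v set \<Rightarrow> ('v \<times> 'a) set" where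
  "letters H C = (SIGMA v:C. carrier (H v) - {\<one>\<^bsub>H v\<^esub>})"

definition reduced :: "('v \<times> 'a) list \<Rightarrow> bool" where
  "reduced w \<longleftrightarrow> distinct_adj (map fst w)"

definition cyclically_reduced :: "('v \<times> 'a) list \<Rightarrow> bool" where
  "cyclically_reduced w \<longleftrightarrow> (\<forall>n. reduced (rotate n w))"

inductive reduction :: "('v \<Rightarrow> 'a monoid) \<Rightarrow> ('v \<times> 'a) list \<Rightarrow> ('v \<times> 'a) list \<Rightarrow> bool"
  for H where
  merge: "g \<otimes>\<^bsub>H v\<^esub> h \<noteq> \<one>\<^bsub>H v\<^esub> \<Longrightarrow>
    reduction H (xs @ [(v, g), (v, h)] @ ys) (xs @ [(v, g \<otimes>\<^bsub>H v\<^esub> h)] @ ys)"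
| cancel: "g \<otimes>\<^bsub>H v\<^esub> h = \<one>\<^bsub>H v\<^esub> \<Longrightarrow>
    reduction H (xs @ [(v, g), (v, h)] @ ys) (xs @ ys)"

text \<open>If all \<open>H v\<close> are groups, the reduced form exists and is unique: see the theorems
  \<open>reduced_form\<close> and \<open>reduced_form_unique\<close> below.\<close>

definition reduced_form :: "('v \<Rightarrow> 'a monoid) \<Rightarrow> ('v \<times> 'a) list \<Rightarrow> ('v \<times> 'a) list" where
  "reduced_form H w = (THE r. reduced r \<and> (reduction H)\<^sup>*\<^sup>* w r)"

definition word_inv :: "('v \<Rightarrow> 'a monoid) \<Rightarrow> ('v \<times> 'a) list \<Rightarrow> ('v \<times> 'a) list" where
  "word_inv H w = rev (map (\<lambda>(v, g). (v, inv\<^bsub>H v\<^esub> g)) w)"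


section \<open>The partial group of a graph and a family of groups\<close>

definition CR :: "('v \<Rightarrow> 'a monoid) \<Rightarrow> 'v set \<Rightarrow> ('v \<times> 'a) list set" where
  "CR H C = {w \<in> lists (letters H C). cyclically_reduced w}"

definition clique_partial_group ::
    "('v \<Rightarrow> 'a monoid) \<Rightarrow> 'v set \<Rightarrow> ('v \<times> 'a) list partial_group" where
  "clique_partial_group H C =
    \<lparr>carrier = CR H C,
     pdom = {us \<in> lists (CR H C).
       \<forall>i j. i < j \<and> j \<le> length us \<longrightarrow> reduced_form H (concat (drop i (take j us))) \<in> CR H C},
     pprod = (\<lambda>us. reduced_form H (concat us)),
     pinv = word_inv H\<rparr>"

text \<open>
  This is the concrete form of the colimit of the partial groups of the (possibly infinite)
  cliques. The product and inverse of \<^const>\<open>clique_partial_group\<close> are given by formulas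
  independent of the clique, and so are those of the union.
\<close>

definition graph_partial_group ::
    "'v pair_pre_digraph \<Rightarrow> ('v \<Rightarrow> 'a monoid) \<Rightarrow> ('v \<times> 'a) list partial_group" where
  "graph_partial_group G H =
    \<lparr>carrier = (\<Union>C\<in>{C. clique G C}. carrier (clique_partial_group H C)),
     pdom = (\<Union>C\<in>{C. clique G C}. pdom (clique_partial_group H C)),
     pprod = (\<lambda>us. reduced_form H (concat us)),
     pinv = word_inv H\<rparr>"

definition path_partial_group :: "'v pair_pre_digraph \<Rightarrow> ('v \<times> int) list partial_group" where
  "path_partial_group G = graph_partial_group G (\<lambda>v. integer_mod_group 2)"


section \<open>Well-definedness\<close>

subsection \<open>Reduced forms\<close>

fun push :: "('v \<Rightarrow> 'a monoid) \<Rightarrow> ('v \<times> 'a) \<Rightarrow> ('v \<times> 'a) list \<Rightarrow> ('v \<times> 'a) list" where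
  "push H a [] = [a]"
| "push H a (b # r) =
    (if fst a \<noteq> fst b then a # b # r
     else if snd a \<otimes>\<^bsub>H (fst a)\<^esub> snd b = \<one>\<^bsub>H (fst a)\<^esub> then r
     else (fst a, snd a \<otimes>\<^bsub>H (fst a)\<^esub> snd b) # r)"

definition nf :: "('v \<Rightarrow> 'a monoid) \<Rightarrow> ('v \<times> 'a) list \<Rightarrow> ('v \<times> 'a) list" where
  "nf H w = foldr (push H) w []"

lemma reduced_Nil [simp]: "reduced []"
  and reduced_single [simp]: "reduced [a]"
  and reduced_Cons2 [simp]: "reduced (a # b # r) \<longleftrightarrow> fst a \<noteq> fst b \<and> reduced (b # r)"
  by (auto simp: reduced_def)

lemma reduced_ConsD: "reduced (a # r) \<Longrightarrow> reduced r"
  by (cases r) auto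

lemma nf_Nil [simp]: "nf H [] = []"
  and nf_Cons [simp]: "nf H (a # w) = push H a (nf H w)"
  by (auto simp: nf_def)

lemma reduced_push: "reduced r \<Longrightarrow> reduced (push H a r)"
  by (cases r rule: remdups_adj.cases) (auto dest: reduced_ConsD)

lemma reduced_nf: "reduced (nf H w)"
  by (induction w) (auto intro: reduced_push)

lemma nf_reduced: "reduced w \<Longrightarrow> nf H w = w"
proof (induction w)
  case (Cons a w)
  then have "nf H w = w" by (auto dest: reduced_ConsD)
  with Cons.prems show ?case by (cases w) auto
qed simp

lemma reduction_context: "reduction H u v \<Longrightarrow> reduction H (p @ u @ s) (p @ v @ s)"
proof (induction rule: reduction.induct)
  case (merge v g h xs ys)
  then show ?case using reduction.merge[of H v g h "p @ xs" "ys @ s"] by simp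
next
  case (cancel v g h xs ys)
  then show ?case using reduction.cancel[of H v g h "p @ xs" "ys @ s"] by simp
qed

lemma reductions_context:
  "(reduction H)\<^sup>*\<^sup>* u v \<Longrightarrow> (reduction H)\<^sup>*\<^sup>* (p @ u @ s) (p @ v @ s)"
  by (induction rule: rtranclp_induct) (auto intro: rtranclp.rtrancl_into_rtrancl reduction_context)

lemma reductions_push: "(reduction H)\<^sup>*\<^sup>* (a # r) (push H a r)"
proof (cases r)
  case (Cons b r')
  obtain v g v' h where ab: "a = (v, g)" "b = (v', h)" by (cases a; cases b) auto
  show ?thesis
  proof (cases "v = v'")
    case True
    with reduction.merge[of H v g h "[]" r'] reduction.cancel[of H v g h "[]" r'] Cons ab
    show ?thesis by (auto intro: r_into_rtranclp)
  qed (use Cons ab in auto)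
qed simp

lemma reductions_nf: "(reduction H)\<^sup>*\<^sup>* w (nf H w)"
proof (induction w)
  case (Cons a w)
  from reductions_context[OF Cons, of "[a]" "[]"]
  have "(reduction H)\<^sup>*\<^sup>* (a # w) (a # nf H w)" by simp
  also have "(reduction H)\<^sup>*\<^sup>* (a # nf H w) (push H a (nf H w))" by (rule reductions_push)
  finally show ?case by simp
qed simp

lemma nf_append: "nf H (u @ v) = foldr (push H) u (nf H v)"
  by (simp add: nf_def)

locale group_family =
  fixes H :: "'v \<Rightarrow> 'a monoid" and V :: "'v set"
  assumes group_H: "v \<in> V \<Longrightarrow> group (H v)"
begin

abbreviation "L \<equiv> letters H V"

lemma push_lists: "a \<in> L \<Longrightarrow> r \<in> lists L \<Longrightarrow> push H a r \<in> lists L"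
proof (cases r)
  case (Cons b r')
  moreover assume "a \<in> L" "r \<in> lists L"
  ultimately show ?thesis
    using group_H[of "fst a"]
    by (auto simp: letters_def intro!: monoid.m_closed group.is_monoid)
qed simp

lemma nf_lists: "w \<in> lists L \<Longrightarrow> nf H w \<in> lists L"
  by (induction w) (simp_all add: push_lists del: in_lists_conv_set)

lemma reduction_lists: "reduction H u w \<Longrightarrow> u \<in> lists L \<Longrightarrow> w \<in> lists L"
proof (induction rule: reduction.induct)
  case (merge v g h xs ys)
  then show ?case using group_H[of v]
    by (auto simp: letters_def intro!: monoid.m_closed group.is_monoid)
qed simp

lemma reductions_lists: "(reduction H)\<^sup>*\<^sup>* u w \<Longrightarrow> u \<in> lists L \<Longrightarrow> w \<in> lists L"
  by (induction rule: rtranclp_induct) (use reduction_lists in blast)+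

lemma push_push:
  assumes "(v, g) \<in> L" "(v, h) \<in> L" "r \<in> lists L" "reduced r"
  shows "push H (v, g) (push H (v, h) r) =
    (if g \<otimes>\<^bsub>H v\<^esub> h = \<one>\<^bsub>H v\<^esub> then r else push H (v, g \<otimes>\<^bsub>H v\<^esub> h) r)"
proof -
  interpret group "H v" using assms group_H[of v] by (auto simp: letters_def)
  have gh: "g \<in> carrier (H v)" "h \<in> carrier (H v)" "g \<noteq> \<one>\<^bsub>H v\<^esub>" "h \<noteq> \<one>\<^bsub>H v\<^esub>"
    using assms by (auto simp: letters_def)
  show ?thesis
  proof (cases r)
    case (Cons b r')
    obtain v' k where b: "b = (v', k)" by (cases b)
    show ?thesis
    proof (cases "v' = v")
      case True
      with b Cons assms have k: "k \<in> carrier (H v)" "k \<noteq> \<one>\<^bsub>H v\<^esub>" by (auto simp: letters_def)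
      have r': "push H (v, x) r' = (v, x) # r'" for x
        using assms(4) Cons b True by (cases r') auto
      have 1: "g = k" if "g \<otimes>\<^bsub>H v\<^esub> h = \<one>\<^bsub>H v\<^esub>" "h \<otimes>\<^bsub>H v\<^esub> k = \<one>\<^bsub>H v\<^esub>"
        using that gh k by (metis inv_equality inv_unique' l_one m_assoc r_one)
      have 2: "g \<otimes>\<^bsub>H v\<^esub> (h \<otimes>\<^bsub>H v\<^esub> k) = k" if "g \<otimes>\<^bsub>H v\<^esub> h = \<one>\<^bsub>H v\<^esub>"
        using that gh k by (metis l_one m_assoc)
      have 3: "g \<otimes>\<^bsub>H v\<^esub> h \<otimes>\<^bsub>H v\<^esub> k = g" if "h \<otimes>\<^bsub>H v\<^esub> k = \<one>\<^bsub>H v\<^esub>"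
        using that gh k by (metis r_one m_assoc)
      show ?thesis
        using Cons b True gh k r' 1 2 3 by (auto simp: m_assoc)
    qed (use Cons b in auto)
  qed auto
qed

lemma nf_reduction: "reduction H u w \<Longrightarrow> u \<in> lists L \<Longrightarrow> nf H u = nf H w"
proof (induction rule: reduction.induct)
  case (merge v g h xs ys)
  then show ?case
    using push_push[of v g h "nf H ys"] nf_lists[of ys] reduced_nf[of H ys]
    by (simp add: nf_append del: push.simps)
next
  case (cancel v g h xs ys)
  then show ?case
    using push_push[of v g h "nf H ys"] nf_lists[of ys] reduced_nf[of H ys]
    by (simp add: nf_append del: push.simps)
qed

lemma nf_reductions: "(reduction H)\<^sup>*\<^sup>* u w \<Longrightarrow> u \<in> lists L \<Longrightarrow> nf H u = nf H w"
proof (induction rule: rtranclp_induct)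
  case (step y z)
  then show ?case using nf_reduction[of y z] reductions_lists[of u y] by simp
qed simp

lemma reduced_form_unique:
  "w \<in> lists L \<Longrightarrow> reduced r \<Longrightarrow> (reduction H)\<^sup>*\<^sup>* w r \<Longrightarrow> r = nf H w"
  using nf_reductions[of w r] nf_reduced[of r H] by simp

lemma reduced_form_nf: "w \<in> lists L \<Longrightarrow> reduced_form H w = nf H w"
  unfolding reduced_form_def
  using reduced_form_unique[of w] reduced_nf[of H w] reductions_nf[of H w] by blast

theorem reduced_form:
  assumes "w \<in> lists L"
  shows "reduced (reduced_form H w)" "(reduction H)\<^sup>*\<^sup>* w (reduced_form H w)"
    "reduced_form H w \<in> lists L"
  using assms reduced_nf[of H w] reductions_nf[of H w] nf_lists[of w]
  by (simp_all only: reduced_form_nf)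

lemma nf_append_nf:
  assumes "u \<in> lists L" "v \<in> lists L" "w \<in> lists L"
  shows "nf H (u @ nf H v @ w) = nf H (u @ v @ w)"
  by (rule nf_reductions[symmetric]) (use assms reductions_context[OF reductions_nf] in auto)


subsection \<open>Inverses\<close>

lemma word_inv_Nil [simp]: "word_inv H [] = []"
  and word_inv_append: "word_inv H (u @ w) = word_inv H w @ word_inv H u"
  by (simp_all add: word_inv_def)

lemma word_inv_lists: "w \<in> lists L \<Longrightarrow> word_inv H w \<in> lists L"
  using group_H by (fastforce simp: word_inv_def letters_def group.inv_eq_1_iff)

lemma word_inv_word_inv: "w \<in> lists L \<Longrightarrow> word_inv H (word_inv H w) = w"
  using group_H
  by (auto simp: word_inv_def letters_def rev_map[symmetric] o_def case_prod_unfold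
      intro!: map_idI prod_eqI)

lemma map_fst_word_inv: "map fst (word_inv H w) = rev (map fst w)"
  by (simp add: word_inv_def rev_map o_def case_prod_unfold)

lemma reduced_word_inv: "reduced (word_inv H w) \<longleftrightarrow> reduced w"
  unfolding reduced_def map_fst_word_inv by simp

lemma cyclically_reduced_iff: "cyclically_reduced w \<longleftrightarrow>
    distinct_adj (map fst w) \<and> (length w \<ge> 2 \<longrightarrow> fst (last w) \<noteq> fst (hd w))"
proof (intro iffI conjI impI)
  assume w: "cyclically_reduced w"
  then show "distinct_adj (map fst w)"
    unfolding cyclically_reduced_def reduced_def using rotate0 by (metis id_apply)
  assume "2 \<le> length w"
  then obtain a b u where "w = a # u @ [b]"
    by (metis One_nat_def Suc_1 Suc_le_length_iff append_butlast_last_id list.distinct(1))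
  moreover have "reduced (rotate (length w - 1) w)" using w by (simp add: cyclically_reduced_def)
  moreover have "rotate (length (a # u)) ((a # u) @ [b]) = [b] @ a # u"
    by (rule rotate_append)
  ultimately show "fst (last w) \<noteq> fst (hd w)" by (simp add: reduced_def)
next
  assume *: "distinct_adj (map fst w) \<and> (length w \<ge> 2 \<longrightarrow> fst (last w) \<noteq> fst (hd w))"
  show "cyclically_reduced w"
    unfolding cyclically_reduced_def
  proof
    fix n
    show "reduced (rotate n w)"
    proof (cases "w = []")
      case False
      define k where "k = n mod length w"
      have eq: "rotate n w = drop k w @ take k w" by (simp add: k_def rotate_drop_take)
      have k: "k < length w" using False by (simp add: k_def)
      have d: "distinct_adj (map fst (take k w) @ map fst (drop k w))"
        using * by (simp flip: map_append)
      show ?thesis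
      proof (cases "k = 0")
        case True
        then show ?thesis using eq * by (simp add: reduced_def)
      next
        case k0: False
        then have "fst (last w) \<noteq> fst (hd w)" using * k by simp
        with d k k0 show ?thesis
          unfolding eq reduced_def by (auto simp: distinct_adj_append_iff last_map hd_map)
      qed
    qed simp
  qed
qed

lemma cyclically_reduced_word_inv: "cyclically_reduced (word_inv H w) \<longleftrightarrow> cyclically_reduced w"
proof (cases "w = []")
  case False
  moreover have len: "length (word_inv H w) = length w" by (simp add: word_inv_def)
  ultimately have ne: "word_inv H w \<noteq> []" by auto
  have "fst (last (word_inv H w)) = fst (hd w)" "fst (hd (word_inv H w)) = fst (last w)"
    using False ne
    by (metis (no_types) last_map hd_map map_fst_word_inv last_rev hd_rev map_is_Nil_conv)+
  then show ?thesis
    unfolding cyclically_reduced_iff by (auto simp: map_fst_word_inv len)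
qed simp

lemma nf_word_inv_append: "w \<in> lists L \<Longrightarrow> s \<in> lists L \<Longrightarrow> nf H (word_inv H w @ w @ s) = nf H s"
proof (induction w arbitrary: s)
  case (Cons a w)
  obtain v g where a: "a = (v, g)" by (cases a)
  have vg: "v \<in> V" "g \<in> carrier (H v)" "g \<noteq> \<one>\<^bsub>H v\<^esub>"
    using Cons.prems a by (auto simp: letters_def)
  have inv: "inv\<^bsub>H v\<^esub> g \<otimes>\<^bsub>H v\<^esub> g = \<one>\<^bsub>H v\<^esub>" using group_H[of v] vg by (simp add: group.l_inv)
  have eq: "word_inv H (a # w) @ (a # w) @ s
      = word_inv H w @ [(v, inv\<^bsub>H v\<^esub> g), (v, g)] @ (w @ s)"
    by (simp add: word_inv_def a)
  have "word_inv H (a # w) @ (a # w) @ s \<in> lists L"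
    using Cons.prems word_inv_lists[of "a # w"] by simp
  then have "nf H (word_inv H (a # w) @ (a # w) @ s) = nf H (word_inv H w @ (w @ s))"
    unfolding eq by (intro nf_reduction reduction.cancel[of H v _ g] inv)
  also have "\<dots> = nf H s" using Cons by simp
  finally show ?case .
qed simp

lemma reduction_word_inv:
  "reduction H u w \<Longrightarrow> u \<in> lists L \<Longrightarrow> reduction H (word_inv H u) (word_inv H w)"
proof (induction rule: reduction.induct)
  case (merge v g h xs ys)
  interpret group "H v" using merge.prems group_H[of v] by (auto simp: letters_def)
  have gh: "g \<in> carrier (H v)" "h \<in> carrier (H v)" using merge.prems by (auto simp: letters_def)
  then have "inv\<^bsub>H v\<^esub> h \<otimes>\<^bsub>H v\<^esub> inv\<^bsub>H v\<^esub> g \<noteq> \<one>\<^bsub>H v\<^esub>"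
    using merge.hyps by (simp add: inv_mult_group[symmetric] inv_eq_1_iff)
  from reduction.merge[of H v "inv\<^bsub>H v\<^esub> h" "inv\<^bsub>H v\<^esub> g", OF this,
      of "word_inv H ys" "word_inv H xs"]
  show ?case using gh by (simp add: word_inv_def inv_mult_group)
next
  case (cancel v g h xs ys)
  interpret group "H v" using cancel.prems group_H[of v] by (auto simp: letters_def)
  have gh: "g \<in> carrier (H v)" "h \<in> carrier (H v)" using cancel.prems by (auto simp: letters_def)
  then have "inv\<^bsub>H v\<^esub> h \<otimes>\<^bsub>H v\<^esub> inv\<^bsub>H v\<^esub> g = \<one>\<^bsub>H v\<^esub>"
    using cancel.hyps by (simp add: inv_mult_group[symmetric])
  from reduction.cancel[of H v "inv\<^bsub>H v\<^esub> h" "inv\<^bsub>H v\<^esub> g", OF this,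
      of "word_inv H ys" "word_inv H xs"]
  show ?case by (simp add: word_inv_def)
qed

lemma reductions_word_inv:
  "(reduction H)\<^sup>*\<^sup>* u w \<Longrightarrow> u \<in> lists L \<Longrightarrow> (reduction H)\<^sup>*\<^sup>* (word_inv H u) (word_inv H w)"
proof (induction rule: rtranclp_induct)
  case (step y z)
  then have "reduction H (word_inv H y) (word_inv H z)"
    using reductions_lists reduction_word_inv by blast
  with step show ?case by simp
qed simp

lemma nf_word_inv:
  assumes "w \<in> lists L"
  shows "nf H (word_inv H w) = word_inv H (nf H w)"
  using reduced_form_unique[OF word_inv_lists[OF assms], of "word_inv H (nf H w)"]
    reductions_word_inv[OF reductions_nf assms]
  by (simp add: reduced_word_inv reduced_nf)

lemma concat_word_inv: "concat (rev (map (word_inv H) us)) = word_inv H (concat us)"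
  by (induction us) (simp_all add: word_inv_append)


subsection \<open>The partial group of a clique\<close>

lemma CR_lists: "CR H V \<subseteq> lists L"
  by (auto simp: CR_def)

lemma Nil_CR [simp]: "[] \<in> CR H V"
  by (simp add: CR_def cyclically_reduced_def)

lemma concat_CR: "us \<in> lists (CR H V) \<Longrightarrow> concat us \<in> lists L"
  using CR_lists by fastforce

lemma word_inv_CR: "w \<in> CR H V \<Longrightarrow> word_inv H w \<in> CR H V"
  using word_inv_lists[of w] cyclically_reduced_word_inv[of w] by (simp add: CR_def)

lemma pdom_clique_iff: "us \<in> pdom (clique_partial_group H V) \<longleftrightarrow>
    us \<in> lists (CR H V) \<and> (\<forall>ps ys ss. us = ps @ ys @ ss \<longrightarrow> nf H (concat ys) \<in> CR H V)"
proof (cases "us \<in> lists (CR H V)")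
  case True
  have "(\<forall>i j. i < j \<and> j \<le> length us \<longrightarrow> reduced_form H (concat (drop i (take j us))) \<in> CR H V)
      \<longleftrightarrow> (\<forall>ps ys ss. us = ps @ ys @ ss \<longrightarrow> nf H (concat ys) \<in> CR H V)"
  proof (intro iffI allI impI)
    fix ps ys ss
    assume *: "\<forall>i j. i < j \<and> j \<le> length us \<longrightarrow>
        reduced_form H (concat (drop i (take j us))) \<in> CR H V" "us = ps @ ys @ ss"
    show "nf H (concat ys) \<in> CR H V"
    proof (cases "ys = []")
      case False
      have "concat ys \<in> lists L" by (rule concat_CR) (use True * in auto)
      with *(1)[rule_format, of "length ps" "length ps + length ys"] *(2) False
      show ?thesis by (simp add: reduced_form_nf)
    qed simp
  next
    fix i j
    assume *: "\<forall>ps ys ss. us = ps @ ys @ ss \<longrightarrow> nf H (concat ys) \<in> CR H V"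
      "i < j \<and> j \<le> length us"
    have "take i (take j us) @ drop i (take j us) = take j us" by (rule append_take_drop_id)
    then have eq: "us = take i us @ drop i (take j us) @ drop j us"
      using *(2) by (metis append.assoc append_take_drop_id less_imp_le min.absorb1 take_take)
    have "concat (drop i (take j us)) \<in> lists L"
      by (rule concat_CR) (use True in \<open>auto dest!: in_set_dropD in_set_takeD\<close>)
    with *(1) eq show "reduced_form H (concat (drop i (take j us))) \<in> CR H V"
      by (metis reduced_form_nf)
  qed
  with True show ?thesis by (simp add: clique_partial_group_def del: in_lists_conv_set)
qed (simp add: clique_partial_group_def)

lemma carrier_clique [simp]: "carrier (clique_partial_group H V) = CR H V"
  and pprod_clique: "us \<in> lists (CR H V) \<Longrightarrow>
    pprod (clique_partial_group H V) us = nf H (concat us)"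
  and pinv_clique [simp]: "pinv (clique_partial_group H V) = word_inv H"
  using concat_CR by (simp_all add: clique_partial_group_def reduced_form_nf)

lemma nf_CR: "x \<in> CR H V \<Longrightarrow> nf H x = x"
  by (simp add: CR_def cyclically_reduced_iff nf_reduced reduced_def)

lemma split_append3:
  assumes "ps @ ys @ ss = u @ w"
  obtains t where "u = ps @ ys @ t" | t where "w = t @ ys @ ss"
    | a b where "u = ps @ a" "w = b @ ss" "ys = a @ b"
  using assms by (auto simp: append_eq_append_conv2)

lemma split_append4:
  assumes "ps @ ys @ ss = u @ [x] @ w"
  obtains t where "u = ps @ ys @ t" | t where "w = t @ ys @ ss"
    | a b where "u = ps @ a" "w = b @ ss" "ys = a @ [x] @ b" | "ys = []"
  using assms
  by (auto simp: append_eq_append_conv2 append_eq_Cons_conv Cons_eq_append_conv)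

lemma pprod_pdom_clique:
  assumes "u @ v @ w \<in> pdom (clique_partial_group H V)"
  shows "u @ [nf H (concat v)] @ w \<in> pdom (clique_partial_group H V)"
  unfolding pdom_clique_iff
proof (intro conjI allI impI)
  have mem: "u \<in> lists (CR H V)" "v \<in> lists (CR H V)" "w \<in> lists (CR H V)"
    using assms by (simp_all add: pdom_clique_iff)
  have seg: "nf H (concat ys) \<in> CR H V" if "u @ v @ w = ps @ ys @ ss" for ps ys ss
    using assms that unfolding pdom_clique_iff by blast
  have "nf H (concat v) \<in> CR H V" by (rule seg) simp
  with mem show "u @ [nf H (concat v)] @ w \<in> lists (CR H V)" by simp
  fix ps ys ss
  assume "u @ [nf H (concat v)] @ w = ps @ ys @ ss"
  from this[symmetric] show "nf H (concat ys) \<in> CR H V"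
  proof (cases rule: split_append4)
    case (1 t)
    then show ?thesis using seg[of ps ys "t @ v @ w"] by simp
  next
    case (2 t)
    then show ?thesis using seg[of "u @ v @ t" ys ss] by simp
  next
    case (3 a b)
    have "concat a \<in> lists L" "concat v \<in> lists L" "concat b \<in> lists L"
      using mem 3 by (intro concat_CR; simp)+
    then have "nf H (concat ys) = nf H (concat (a @ v @ b))"
      using 3 nf_append_nf[of "concat a" "concat v" "concat b"] by simp
    then show ?thesis using seg[of ps "a @ v @ b" ss] 3 by simp
  qed simp
qed

lemma pinv_pdom_clique:
  assumes "u \<in> pdom (clique_partial_group H V)"
  shows "rev (map (word_inv H) u) @ u \<in> pdom (clique_partial_group H V)"
  unfolding pdom_clique_iff
proof (intro conjI allI impI)
  have mem: "u \<in> lists (CR H V)"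
    using assms by (simp add: pdom_clique_iff)
  have seg: "nf H (concat ys) \<in> CR H V" if "u = ps @ ys @ ss" for ps ys ss
    using assms that unfolding pdom_clique_iff by blast
  show "rev (map (word_inv H) u) @ u \<in> lists (CR H V)"
    using mem word_inv_CR by auto
  have seg': "nf H (word_inv H (concat ys)) \<in> CR H V" if "u = ps @ ys @ ss" for ps ys ss
  proof -
    have "concat ys \<in> lists L" by (rule concat_CR) (use mem that in auto)
    then show ?thesis using seg[OF that] by (simp add: nf_word_inv word_inv_CR)
  qed
  have split: "\<exists>p q. u = q @ p \<and> xs = rev (map (word_inv H) p) \<and> ys = rev (map (word_inv H) q)"
    if "rev (map (word_inv H) u) = xs @ ys" for xs ys
  proof -
    have "map (word_inv H) u = rev ys @ rev xs" using that by (simp add: rev_swap)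
    then show ?thesis by (auto simp: map_eq_append_conv rev_swap)
  qed
  fix ps ys ss
  assume "rev (map (word_inv H) u) @ u = ps @ ys @ ss"
  from this[symmetric] show "nf H (concat ys) \<in> CR H V"
  proof (cases rule: split_append3)
    case (1 t)
    from split[of "ps @ ys" t] 1 obtain p q where pq: "u = q @ p"
      "ps @ ys = rev (map (word_inv H) p)" by auto
    from pq(2) have "map (word_inv H) p = rev ys @ rev ps" by (metis rev_append rev_rev_ident)
    then obtain y z where "p = y @ z" "rev ys = map (word_inv H) y"
      by (auto simp: map_eq_append_conv)
    then have "u = q @ y @ z" "ys = rev (map (word_inv H) y)" using pq by (auto simp: rev_swap)
    with seg'[of q y z] show ?thesis by (simp add: concat_word_inv)
  next
    case (2 t)
    then show ?thesis by (rule seg)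
  next
    case (3 a b)
    from split[of ps a] 3 obtain p q where pq: "u = q @ p" "a = rev (map (word_inv H) q)" by auto
    from 3(2) pq(1) have "q @ p = b @ ss" by simp
    then consider t where "q = b @ t" "ss = t @ p" | t where "b = q @ t" "p = t @ ss"
      by (auto simp: append_eq_append_conv2)
    then show ?thesis
    proof cases
      case (1 t)
      have "concat b \<in> lists L" by (rule concat_CR) (use mem 3 in auto)
      from nf_word_inv_append[OF this, of "[]"]
      have "nf H (concat ys) = nf H (word_inv H (concat t))"
        using 1 3 pq by (simp add: concat_word_inv word_inv_append nf_def)
      then show ?thesis using seg'[of b t p] 1 pq by simp
    next
      case (2 t)
      have "concat q \<in> lists L" "concat t \<in> lists L"
        using mem 2 pq by (intro concat_CR; simp)+
      then have "nf H (concat ys) = nf H (concat t)"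
        using nf_word_inv_append[of "concat q" "concat t"] 2 3 pq by (simp add: concat_word_inv)
      then show ?thesis using seg[of q t ss] 2 pq by simp
    qed
  qed
qed

theorem partial_group_clique: "partial_group (clique_partial_group H V)"
proof
  let ?M = "clique_partial_group H V"
  show "carrier ?M \<noteq> {}" by (metis Nil_CR carrier_clique empty_iff)
  show "pdom ?M \<subseteq> lists (carrier ?M)" by (auto simp: pdom_clique_iff)
  show "[x] \<in> pdom ?M" if "x \<in> carrier ?M" for x
    using that nf_CR by (auto simp: pdom_clique_iff append_eq_Cons_conv Cons_eq_append_conv)
  show "u \<in> pdom ?M \<and> v \<in> pdom ?M" if "u @ v \<in> pdom ?M" for u v
  proof -
    have seg: "nf H (concat ys) \<in> CR H V" if "u @ v = ps @ ys @ ss" for ps ys ss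
      using \<open>u @ v \<in> pdom ?M\<close> that unfolding pdom_clique_iff by blast
    have "nf H (concat ys) \<in> CR H V" if "u = ps @ ys @ ss" for ps ys ss
      by (rule seg[of ps ys "ss @ v"]) (simp add: that)
    moreover have "nf H (concat ys) \<in> CR H V" if "v = ps @ ys @ ss" for ps ys ss
      by (rule seg[of "u @ ps" ys ss]) (simp add: that)
    moreover have "u \<in> lists (CR H V)" "v \<in> lists (CR H V)"
      using that by (simp_all add: pdom_clique_iff)
    ultimately show ?thesis unfolding pdom_clique_iff by blast
  qed
  show "pprod ?M u \<in> carrier ?M" if "u \<in> pdom ?M" for u
  proof -
    have "nf H (concat u) \<in> CR H V"
      using that unfolding pdom_clique_iff by (metis append_Nil append_Nil2)
    then show ?thesis using that by (simp add: pdom_clique_iff pprod_clique)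
  qed
  show "pprod ?M [x] = x" if "x \<in> carrier ?M" for x
    using that nf_CR by (simp add: pprod_clique)
  show "u @ [pprod ?M v] @ w \<in> pdom ?M" and "pprod ?M (u @ v @ w) = pprod ?M (u @ [pprod ?M v] @ w)"
    if *: "u @ v @ w \<in> pdom ?M" for u v w
  proof -
    have mem: "u \<in> lists (CR H V)" "v \<in> lists (CR H V)" "w \<in> lists (CR H V)"
      using * by (simp_all add: pdom_clique_iff)
    note 1 = pprod_pdom_clique[OF *]
    then show "u @ [pprod ?M v] @ w \<in> pdom ?M" by (simp add: pprod_clique mem del: in_lists_conv_set)
    have "u @ [nf H (concat v)] @ w \<in> lists (CR H V)" using 1 by (simp add: pdom_clique_iff)
    then show "pprod ?M (u @ v @ w) = pprod ?M (u @ [pprod ?M v] @ w)"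
      using mem nf_append_nf[of "concat u" "concat v" "concat w"] concat_CR
      by (simp add: pprod_clique)
  qed
  show "pinv ?M x \<in> carrier ?M" "pinv ?M (pinv ?M x) = x" if "x \<in> carrier ?M" for x
    using that word_inv_CR word_inv_word_inv[of x] CR_lists by auto
  show "rev (map (pinv ?M) u) @ u \<in> pdom ?M" if "u \<in> pdom ?M" for u
    using pinv_pdom_clique[OF that] by simp
  show "pprod ?M (rev (map (pinv ?M) u) @ u) = pprod ?M []" if "u \<in> pdom ?M" for u
  proof -
    have mem: "u \<in> lists (CR H V)" using that by (simp add: pdom_clique_iff)
    have "rev (map (word_inv H) u) @ u \<in> lists (CR H V)"
      using pinv_pdom_clique[OF that] by (simp add: pdom_clique_iff)
    then show ?thesis
      using nf_word_inv_append[OF concat_CR[OF mem], of "[]"]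
      by (simp add: pprod_clique concat_word_inv)
  qed
qed

end


subsection \<open>The partial group of a graph\<close>

theorem partial_group_graph:
  assumes "\<And>v. v \<in> pverts G \<Longrightarrow> group (H v)"
  shows "partial_group (graph_partial_group G H)"
proof -
  let ?M = "graph_partial_group G H" and ?N = "clique_partial_group H"
  have pg: "partial_group (?N C)" if "clique G C" for C
    by (rule group_family.partial_group_clique, rule group_family.intro)
      (use assms that in \<open>auto simp: clique_def\<close>)
  have [simp]: "pprod (?N C) = pprod ?M" "pinv (?N C) = pinv ?M" for C
    by (simp_all add: clique_partial_group_def graph_partial_group_def)
  have carrier: "x \<in> carrier ?M \<longleftrightarrow> (\<exists>C. clique G C \<and> x \<in> carrier (?N C))" for x
    by (auto simp: graph_partial_group_def)
  have pdom: "x \<in> pdom ?M \<longleftrightarrow> (\<exists>C. clique G C \<and> x \<in> pdom (?N C))" for x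
    by (auto simp: graph_partial_group_def)
  have "clique G {}" by (simp add: clique_def)
  note 0 = this partial_group.carrier_nonempty[OF pg[OF this]]
  show ?thesis
  proof
    show "carrier ?M \<noteq> {}" using 0 carrier by blast
    show "pdom ?M \<subseteq> lists (carrier ?M)"
    proof
      fix u assume "u \<in> pdom ?M"
      then obtain C where "clique G C" "u \<in> pdom (?N C)" using pdom by auto
      then show "u \<in> lists (carrier ?M)"
        using partial_group.pdom_subset[OF pg] carrier by fastforce
    qed
  next
    fix x assume "x \<in> carrier ?M"
    then obtain C where C: "clique G C" "x \<in> carrier (?N C)" using carrier by auto
    interpret partial_group "?N C" using pg C by simp
    show "[x] \<in> pdom ?M" "pprod ?M [x] = x" "pinv ?M x \<in> carrier ?M" "pinv ?M (pinv ?M x) = x"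
      using C singleton_pdom pprod_singleton pinv_closed pinv_pinv by (auto simp: carrier pdom)
  next
    fix u v assume "u @ v \<in> pdom ?M"
    then show "u \<in> pdom ?M \<and> v \<in> pdom ?M"
      using pdom partial_group.append_pdomD[OF pg] by blast
  next
    fix u assume "u \<in> pdom ?M"
    then obtain C where C: "clique G C" "u \<in> pdom (?N C)" using pdom by auto
    interpret partial_group "?N C" using pg C by simp
    show "pprod ?M u \<in> carrier ?M" "rev (map (pinv ?M) u) @ u \<in> pdom ?M"
      "pprod ?M (rev (map (pinv ?M) u) @ u) = pprod ?M []"
      using C pprod_closed[of u] pinv_pdom[of u] pprod_pinv[of u] by (auto simp: carrier pdom)
  next
    fix u v w assume "u @ v @ w \<in> pdom ?M"
    then obtain C where C: "clique G C" "u @ v @ w \<in> pdom (?N C)" using pdom by auto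
    interpret partial_group "?N C" using pg C by simp
    show "u @ [pprod ?M v] @ w \<in> pdom ?M"
      "pprod ?M (u @ v @ w) = pprod ?M (u @ [pprod ?M v] @ w)"
      using C(1) pprod_pdom[OF C(2)] pprod_assoc[OF C(2)] by (simp_all add: pdom) blast
  qed
qed

corollary partial_group_path: "partial_group (path_partial_group G)"
  unfolding path_partial_group_def by (rule partial_group_graph) simp


subsection \<open>Automorphism groups\<close>

lemma subgroup_BijGroupI:
  assumes "A \<subseteq> Bij S" "(\<lambda>x\<in>S. x) \<in> A"
    and "\<And>f g. f \<in> A \<Longrightarrow> g \<in> A \<Longrightarrow> compose S f g \<in> A"
    and "\<And>f. f \<in> A \<Longrightarrow> restrict (inv_into S f) S \<in> A"
  shows "group (BijGroup S \<lparr>carrier := A\<rparr>)"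
proof (rule subgroup.subgroup_is_group[OF _ group_BijGroup], unfold_locales)
  show "inv\<^bsub>BijGroup S\<^esub> f \<in> A" if "f \<in> A" for f
    using that assms by (subst inv_BijGroup) auto
qed (use assms in \<open>auto simp: BijGroup_def\<close>)

lemma inv_into_compose_Bij:
  assumes "f \<in> Bij S" "g \<in> Bij S" "x \<in> S"
  shows "inv_into S (compose S f g) x = inv_into S g (inv_into S f x)"
proof (rule inv_into_f_eq)
  show "inj_on (compose S f g) S"
    using compose_Bij[OF assms(1,2)] by (simp add: Bij_def bij_betw_def)
  have "f ` S = S" "g ` S = S" using assms by (auto simp: Bij_def bij_betw_def)
  then show "inv_into S g (inv_into S f x) \<in> S"
    "compose S f g (inv_into S g (inv_into S f x)) = x"
    using assms(3) by (simp_all add: compose_def inv_into_into f_inv_into_f)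
qed

lemma inv_into_inv_Bij:
  assumes "f \<in> Bij S" "x \<in> S"
  shows "inv_into S (restrict (inv_into S f) S) x = f x"
proof (rule inv_into_f_eq)
  show "inj_on (restrict (inv_into S f) S) S"
    using restrict_inv_into_Bij[OF assms(1)] by (simp add: Bij_def bij_betw_def)
  show "f x \<in> S" using Bij_imp_funcset[OF assms(1)] assms(2) by auto
  then show "restrict (inv_into S f) S (f x) = x"
    using assms by (simp add: Bij_def bij_betw_def)
qed

lemma inv_into_id: "x \<in> S \<Longrightarrow> inv_into S (\<lambda>x\<in>S. x) x = x"
  by (intro inv_into_f_eq) (auto simp: inj_on_def)

lemma graph_hom_cong:
  assumes "pair_wf_digraph G" "f \<in> graph_hom G K" "\<And>v. v \<in> pverts G \<Longrightarrow> f v = g v"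
  shows "g \<in> graph_hom G K"
proof -
  have "(g u, g v) \<in> parcs K" if "(u, v) \<in> parcs G" for u v
  proof -
    have "(f u, f v) \<in> parcs K" using assms(2) that by (simp add: graph_hom_def)
    then show ?thesis using assms(3) pair_wf_digraph.wellformed'[OF assms(1) that] by simp
  qed
  moreover have "g \<in> pverts G \<rightarrow> pverts K"
    using assms(2,3) by (fastforce simp: graph_hom_def Pi_iff)
  ultimately show ?thesis by (simp add: graph_hom_def)
qed

lemma graph_hom_comp: "f \<in> graph_hom K L \<Longrightarrow> g \<in> graph_hom G K \<Longrightarrow> (\<lambda>x. f (g x)) \<in> graph_hom G L"
  by (auto simp: graph_hom_def)

theorem group_Aut_Graphs:
  assumes "pair_wf_digraph G"
  shows "group (Aut_Graphs G)"
  unfolding Aut_Graphs_def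
proof (rule subgroup_BijGroupI)
  let ?V = "pverts G"
  note cong = graph_hom_cong[OF assms]
  have id: "(\<lambda>x. x) \<in> graph_hom G G" by (auto simp: graph_hom_def)
  show "(\<lambda>x\<in>?V. x) \<in> graph_iso G G \<inter> Bij ?V"
  proof -
    have "(\<lambda>x\<in>?V. x) \<in> graph_hom G G" by (rule cong[OF id]) simp
    moreover have "inv_into ?V (\<lambda>x\<in>?V. x) \<in> graph_hom G G"
      by (rule cong[OF id]) (simp add: inv_into_id)
    moreover note id_Bij[of ?V]
    ultimately show ?thesis unfolding graph_iso_def Bij_def by blast
  qed
  show "compose ?V f g \<in> graph_iso G G \<inter> Bij ?V"
    if *: "f \<in> graph_iso G G \<inter> Bij ?V" "g \<in> graph_iso G G \<inter> Bij ?V" for f g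
  proof -
    have fg: "f \<in> graph_hom G G" "inv_into ?V f \<in> graph_hom G G" "f \<in> Bij ?V"
      "g \<in> graph_hom G G" "inv_into ?V g \<in> graph_hom G G" "g \<in> Bij ?V"
      using * by (auto simp: graph_iso_def)
    have "compose ?V f g \<in> graph_hom G G"
      by (rule cong[OF graph_hom_comp[OF fg(1,4)]]) (simp add: compose_eq)
    moreover have "inv_into ?V (compose ?V f g) \<in> graph_hom G G"
      by (rule cong[OF graph_hom_comp[OF fg(5,2)]]) (simp add: inv_into_compose_Bij[OF fg(3,6)])
    moreover note compose_Bij[OF fg(3,6)]
    ultimately show ?thesis unfolding graph_iso_def Bij_def by blast
  qed
  show "restrict (inv_into ?V f) ?V \<in> graph_iso G G \<inter> Bij ?V"
    if *: "f \<in> graph_iso G G \<inter> Bij ?V" for f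
  proof -
    have f: "f \<in> graph_hom G G" "inv_into ?V f \<in> graph_hom G G" "f \<in> Bij ?V"
      using * by (auto simp: graph_iso_def)
    have "restrict (inv_into ?V f) ?V \<in> graph_hom G G" by (rule cong[OF f(2)]) simp
    moreover have "inv_into ?V (restrict (inv_into ?V f) ?V) \<in> graph_hom G G"
      by (rule cong[OF f(1)]) (simp add: inv_into_inv_Bij[OF f(3)])
    moreover note restrict_inv_into_Bij[OF f(3)]
    ultimately show ?thesis unfolding graph_iso_def Bij_def by blast
  qed
qed auto

context partial_group
begin

lemma part_hom_cong:
  assumes "f \<in> part_hom M N" "\<And>x. x \<in> carrier M \<Longrightarrow> f x = g x"
  shows "g \<in> part_hom M N"
proof -
  have "map g u \<in> pdom N \<and> pprod N (map g u) = g (pprod M u)" if "u \<in> pdom M" for u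
  proof -
    have "map g u = map f u" using that pdom_subset assms(2) by fastforce
    moreover have "map f u \<in> pdom N \<and> pprod N (map f u) = f (pprod M u)"
      using assms(1) that by (simp add: part_hom_def)
    ultimately show ?thesis using assms(2)[OF pprod_closed[OF that]] by metis
  qed
  moreover have "g \<in> carrier M \<rightarrow> carrier N"
    using assms by (fastforce simp: part_hom_def Pi_iff)
  ultimately show ?thesis by (simp add: part_hom_def)
qed

lemma part_hom_comp: "f \<in> part_hom N L \<Longrightarrow> g \<in> part_hom M N \<Longrightarrow> (\<lambda>x. f (g x)) \<in> part_hom M L"
proof -
  have "map (\<lambda>x. f (g x)) u = map f (map g u)" for u by simp
  then show "f \<in> part_hom N L \<Longrightarrow> g \<in> part_hom M N \<Longrightarrow> (\<lambda>x. f (g x)) \<in> part_hom M L"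
    unfolding part_hom_def Pi_iff by (simp del: map_map)
qed

theorem group_Aut_Part: "group (Aut_Part M)"
  unfolding Aut_Part_def
proof (rule subgroup_BijGroupI)
  let ?V = "carrier M"
  note cong = part_hom_cong
  have id: "(\<lambda>x. x) \<in> part_hom M M" by (auto simp: part_hom_def)
  show "(\<lambda>x\<in>?V. x) \<in> part_iso M M \<inter> Bij ?V"
  proof -
    have "(\<lambda>x\<in>?V. x) \<in> part_hom M M" by (rule cong[OF id]) simp
    moreover have "inv_into ?V (\<lambda>x\<in>?V. x) \<in> part_hom M M"
      by (rule cong[OF id]) (simp add: inv_into_id)
    moreover note id_Bij[of ?V]
    ultimately show ?thesis unfolding part_iso_def Bij_def by blast
  qed
  show "compose ?V f g \<in> part_iso M M \<inter> Bij ?V"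
    if *: "f \<in> part_iso M M \<inter> Bij ?V" "g \<in> part_iso M M \<inter> Bij ?V" for f g
  proof -
    have fg: "f \<in> part_hom M M" "inv_into ?V f \<in> part_hom M M" "f \<in> Bij ?V"
      "g \<in> part_hom M M" "inv_into ?V g \<in> part_hom M M" "g \<in> Bij ?V"
      using * by (auto simp: part_iso_def)
    have "compose ?V f g \<in> part_hom M M"
      by (rule cong[OF part_hom_comp[OF fg(1,4)]]) (simp add: compose_eq)
    moreover have "inv_into ?V (compose ?V f g) \<in> part_hom M M"
      by (rule cong[OF part_hom_comp[OF fg(5,2)]]) (simp add: inv_into_compose_Bij[OF fg(3,6)])
    moreover note compose_Bij[OF fg(3,6)]
    ultimately show ?thesis unfolding part_iso_def Bij_def by blast
  qed
  show "restrict (inv_into ?V f) ?V \<in> part_iso M M \<inter> Bij ?V"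
    if *: "f \<in> part_iso M M \<inter> Bij ?V" for f
  proof -
    have f: "f \<in> part_hom M M" "inv_into ?V f \<in> part_hom M M" "f \<in> Bij ?V"
      using * by (auto simp: part_iso_def)
    have "restrict (inv_into ?V f) ?V \<in> part_hom M M" by (rule cong[OF f(2)]) simp
    moreover have "inv_into ?V (restrict (inv_into ?V f) ?V) \<in> part_hom M M"
      by (rule cong[OF f(1)]) (simp add: inv_into_inv_Bij[OF f(3)])
    moreover note restrict_inv_into_Bij[OF f(3)]
    ultimately show ?thesis unfolding part_iso_def Bij_def by blast
  qed
qed auto

end

end

theory Submission
  imports Defs
begin

text \<open>
  A graph automorphism acts on the words over the vertices letter by letter. It maps cliques to
  cliques injectively, so the action respects reduction and cyclic reducedness, and is an
  automorphism of the path partial group. The content of the theorem is that there are no other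
  automorphisms. More generally, every injective homomorphism \<open>\<phi>\<close> between path partial groups is the
  letterwise action of a graph homomorphism (\<open>inj_part_hom_eq_relabel\<close>), for three reasons.

  \<^item> The words of length 1, that is the vertices, are recognised by the partial group structure:
    they are the nontrivial \<open>x\<close> for which \<open>(x, x)\<close> has a product and this product is \<open>1\<close>. A
    cyclically reduced word of length at least 2 can be squared without any cancellation, so it is
    not an involution. Hence \<open>\<phi>\<close> maps vertices to vertices.

  \<^item> Adjacency of distinct vertices \<open>u\<close>, \<open>v\<close> is recognised as well: it means that \<open>(u, v)\<close> has a
    product. Hence \<open>\<phi>\<close> is a graph homomorphism \<open>f\<close> on the vertices.

  \<^item> Every cyclically reduced word of length at least 2 is a concatenation of two shorter cyclically
    reduced words (\<open>cyclically_reduced_split\<close>), and this concatenation is a product in the partial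
    group. By induction on the length, \<open>\<phi>\<close> is determined by its values on vertices, and therefore
    agrees with the letterwise action of \<open>f\<close>.

  Applied to an automorphism and to its inverse, this gives mutually inverse graph homomorphisms.
\<close>

section \<open>Cyclically reduced words\<close>

text \<open>The characterisation \<open>cyclically_reduced_iff\<close> speaks of words only, but lives in the context
  of a family of groups; any family serves to extract it.\<close>

lemma cyclically_reduced_altdef: "cyclically_reduced w \<longleftrightarrow>
    distinct_adj (map fst w) \<and> (length w \<ge> 2 \<longrightarrow> fst (last w) \<noteq> fst (hd w))"
proof -
  interpret group_family "\<lambda>_. integer_mod_group 2" UNIV by (rule group_family.intro) simp
  show ?thesis by (rule cyclically_reduced_iff)
qed

text \<open>
  Splitting off the first letter \<open>a\<close> of \<open>a b r\<close> fails only if \<open>b r\<close> begins and ends in the same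
  group. In that case \<open>r\<close> does not, since its last letter is in the group of \<open>b\<close> and its first
  letter is not, and splitting off the first two letters works.
\<close>

lemma cyclically_reduced_split:
  assumes "cyclically_reduced w" "length w \<ge> 2"
  obtains u v where "w = u @ v" "u \<noteq> []" "v \<noteq> []" "cyclically_reduced u" "cyclically_reduced v"
proof -
  obtain a b r where w: "w = a # b # r"
    using assms(2) by (cases w rule: remdups_adj.cases) auto
  have ab: "fst a \<noteq> fst b" and br: "distinct_adj (map fst (b # r))"
    using assms(1) w by (auto simp: cyclically_reduced_altdef)
  show ?thesis
  proof (cases "r \<noteq> [] \<and> fst (last r) = fst b")
    case False
    then have "cyclically_reduced [a]" "cyclically_reduced (b # r)"
      using br by (auto simp: cyclically_reduced_altdef)
    then show ?thesis using that[of "[a]" "b # r"] w by simp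
  next
    case True
    then obtain c s where r: "r = c # s" by (cases r) auto
    then have "cyclically_reduced [a, b]" "cyclically_reduced r"
      using ab br True by (auto simp: cyclically_reduced_altdef)
    then show ?thesis using that[of "[a, b]" r] w True by simp
  qed
qed

lemma cyclically_reduced_square:
  assumes "cyclically_reduced w" "length w \<ge> 2"
  shows "reduced (w @ w)"
  using assms by (auto simp: cyclically_reduced_altdef reduced_def distinct_adj_append_iff last_map hd_map)


section \<open>The letterwise action of a graph homomorphism\<close>

definition relabel :: "('v \<Rightarrow> 'w) \<Rightarrow> ('v \<times> 'a) list \<Rightarrow> ('w \<times> 'a) list" where
  "relabel f = map (apfst f)"

lemma relabel_Nil [simp]: "relabel f [] = []"
  and relabel_Cons [simp]: "relabel f ((v, g) # w) = (f v, g) # relabel f w"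
  and relabel_append [simp]: "relabel f (u @ w) = relabel f u @ relabel f w"
  by (simp_all add: relabel_def)

lemma relabel_relabel: "relabel f (relabel g w) = relabel (\<lambda>v. f (g v)) w"
  by (auto simp: relabel_def)

lemma concat_map_relabel: "concat (map (relabel f) us) = relabel f (concat us)"
  by (induction us) simp_all

lemma map_fst_relabel: "map fst (relabel f w) = map f (map fst w)"
  by (simp add: relabel_def)

text \<open>A map that is injective on the groups occurring in a word creates no new coincidence between
  neighbouring letters; the same principle makes relabelling commute with reduction below.\<close>

lemma cyclically_reduced_relabel:
  assumes "inj_on f C" "fst ` set w \<subseteq> C" "cyclically_reduced w"
  shows "cyclically_reduced (relabel f w)"
proof (cases "w = []")
  case False
  then have mem: "fst (last w) \<in> C" "fst (hd w) \<in> C" using assms(2) by auto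
  have "distinct_adj (map f (map fst w))"
    by (rule distinct_adj_mapI)
      (use assms in \<open>auto simp: cyclically_reduced_altdef simp del: map_map intro: inj_on_subset\<close>)
  moreover have "fst (last (relabel f w)) = f (fst (last w))"
    "fst (hd (relabel f w)) = f (fst (hd w))" "length (relabel f w) = length w"
    using False by (simp_all add: relabel_def last_map hd_map)
  ultimately show ?thesis
    using assms(3) inj_onD[OF assms(1) _ mem]
    unfolding cyclically_reduced_altdef map_fst_relabel by auto
qed (simp add: cyclically_reduced_altdef)

lemma letters_fst: "w \<in> lists (letters H C) \<Longrightarrow> fst ` set w \<subseteq> C"
  by (auto simp: letters_def)

lemma relabel_letters:
  assumes "w \<in> lists (letters (\<lambda>_. K) C)"
  shows "relabel f w \<in> lists (letters (\<lambda>_. K) (f ` C))"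
  using assms by (fastforce simp: letters_def relabel_def)

context
  fixes f :: "'v \<Rightarrow> 'w" and K :: "'a monoid" and C :: "'v set"
  assumes K: "group K" and inj: "inj_on f C"
begin

interpretation C: group_family "\<lambda>_. K" C by (rule group_family.intro) (rule K)

lemma push_relabel:
  assumes "a \<in> letters (\<lambda>_. K) C" "r \<in> lists (letters (\<lambda>_. K) C)"
  shows "push (\<lambda>_. K) (apfst f a) (relabel f r) = relabel f (push (\<lambda>_. K) a r)"
  using assms inj_on_eq_iff[OF inj]
  by (cases a; cases r) (auto simp: letters_def relabel_def)

lemma nf_relabel:
  "w \<in> lists (letters (\<lambda>_. K) C) \<Longrightarrow> nf (\<lambda>_. K) (relabel f w) = relabel f (nf (\<lambda>_. K) w)"
proof (induction w)
  case (Cons a w)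
  have "nf (\<lambda>_. K) (relabel f (a # w)) = push (\<lambda>_. K) (apfst f a) (nf (\<lambda>_. K) (relabel f w))"
    by (simp add: relabel_def)
  also have "\<dots> = push (\<lambda>_. K) (apfst f a) (relabel f (nf (\<lambda>_. K) w))" using Cons by simp
  also have "\<dots> = relabel f (nf (\<lambda>_. K) (a # w))"
    using Cons.prems by (simp add: push_relabel C.nf_lists del: in_lists_conv_set)
  finally show ?case .
qed simp

lemma relabel_CR: "w \<in> CR (\<lambda>_. K) C \<Longrightarrow> relabel f w \<in> CR (\<lambda>_. K) (f ` C)"
  unfolding CR_def
  using relabel_letters cyclically_reduced_relabel[OF inj letters_fst] by blast

lemma relabel_pdom:
  assumes "us \<in> pdom (clique_partial_group (\<lambda>_. K) C)"
  shows "map (relabel f) us \<in> pdom (clique_partial_group (\<lambda>_. K) (f ` C))"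
proof -
  interpret D: group_family "\<lambda>_. K" "f ` C" by (rule group_family.intro) (rule K)
  have us: "us \<in> lists (CR (\<lambda>_. K) C)"
    and seg: "\<And>ps ys ss. us = ps @ ys @ ss \<Longrightarrow> nf (\<lambda>_. K) (concat ys) \<in> CR (\<lambda>_. K) C"
    using assms unfolding C.pdom_clique_iff by blast+
  have "nf (\<lambda>_. K) (concat ys) \<in> CR (\<lambda>_. K) (f ` C)"
    if split: "map (relabel f) us = ps @ ys @ ss" for ps ys ss
  proof -
    obtain ps' ys' ss' where *: "us = ps' @ ys' @ ss'" "ys = map (relabel f) ys'"
      using split by (auto simp: map_eq_append_conv append_eq_map_conv)
    have "concat ys' \<in> lists (letters (\<lambda>_. K) C)" by (rule C.concat_CR) (use us * in auto)
    then show ?thesis using relabel_CR[OF seg[OF *(1)]] *(2)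
      by (simp add: concat_map_relabel nf_relabel del: in_lists_conv_set)
  qed
  moreover have "map (relabel f) us \<in> lists (CR (\<lambda>_. K) (f ` C))"
    using us relabel_CR by auto
  ultimately show ?thesis unfolding D.pdom_clique_iff by blast
qed

end

text \<open>Graphs have no loops, so a graph homomorphism cannot identify adjacent vertices. This is
  where a homomorphism becomes injective on the words over a fixed clique, although it need not be
  injective on the graph.\<close>

lemma graph_hom_clique:
  assumes "pair_bidirected_digraph K" "f \<in> graph_hom G K" "clique G C"
  shows "inj_on f C" "clique K (f ` C)"
proof -
  interpret K: pair_bidirected_digraph K by fact
  have arc: "(f u, f v) \<in> parcs K" if "u \<in> C" "v \<in> C" "u \<noteq> v" for u v
    using assms(2,3) that by (auto simp: graph_hom_def clique_def)
  show "inj_on f C"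
    using arc K.no_loops' by (fastforce intro!: inj_onI)
  show "clique K (f ` C)"
    using arc assms(2,3) by (fastforce simp: graph_hom_def clique_def)
qed

lemma pprod_graph:
  assumes "\<And>v. group (H v)" "us \<in> lists (CR H C)"
  shows "pprod (graph_partial_group G H) us = nf H (concat us)"
proof -
  interpret group_family H C by (rule group_family.intro) (rule assms)
  show ?thesis using pprod_clique[OF assms(2)]
    by (simp add: graph_partial_group_def clique_partial_group_def)
qed

lemma carrier_graph: "carrier (graph_partial_group G H) = (\<Union>C\<in>{C. clique G C}. CR H C)"
  by (simp add: graph_partial_group_def clique_partial_group_def)

lemma pdom_graph_iff: "us \<in> pdom (graph_partial_group G H) \<longleftrightarrow>
    (\<exists>C. clique G C \<and> us \<in> pdom (clique_partial_group H C))"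
  by (auto simp: graph_partial_group_def)

lemma pdom_clique_lists: "us \<in> pdom (clique_partial_group H C) \<Longrightarrow> us \<in> lists (CR H C)"
  by (simp add: clique_partial_group_def)

text \<open>For a fixed group at every vertex, the partial group of a graph is functorial in the graph:
  words and products live over a single clique, and the homomorphism is injective there.\<close>

lemma part_hom_relabel:
  assumes "pair_bidirected_digraph L" "group K" "f \<in> graph_hom G L"
  shows "relabel f \<in> part_hom (graph_partial_group G (\<lambda>_. K)) (graph_partial_group L (\<lambda>_. K))"
    (is "_ \<in> part_hom ?M ?N")
proof -
  note hom = graph_hom_clique[OF assms(1,3)]
  have "relabel f w \<in> carrier ?N" if "w \<in> carrier ?M" for w
  proof -
    obtain C where C: "clique G C" "w \<in> CR (\<lambda>_. K) C" using \<open>w \<in> carrier ?M\<close> by (auto simp: carrier_graph)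
    then show ?thesis
      using relabel_CR[OF assms(2) hom(1)] hom(2) by (auto simp: carrier_graph)
  qed
  moreover have "map (relabel f) us \<in> pdom ?N"
    "pprod ?N (map (relabel f) us) = relabel f (pprod ?M us)" if us: "us \<in> pdom ?M" for us
  proof -
    obtain C where C: "clique G C" and usC: "us \<in> pdom (clique_partial_group (\<lambda>_. K) C)"
      using us by (auto simp: pdom_graph_iff)
    interpret group_family "\<lambda>_. K" C by (rule group_family.intro) (rule assms)
    note mem = pdom_clique_lists[OF usC]
    have fus: "map (relabel f) us \<in> pdom (clique_partial_group (\<lambda>_. K) (f ` C))"
      by (rule relabel_pdom[OF assms(2) hom(1)[OF C] usC])
    then show "map (relabel f) us \<in> pdom ?N" using hom(2)[OF C] by (auto simp: pdom_graph_iff)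
    show "pprod ?N (map (relabel f) us) = relabel f (pprod ?M us)"
      using mem pdom_clique_lists[OF fus] nf_relabel[OF assms(2) hom(1)[OF C] concat_CR[OF mem]]
      by (simp add: pprod_graph[where C = C] pprod_graph[where C = "f ` C"] assms(2)
          concat_map_relabel del: in_lists_conv_set)
  qed
  ultimately show ?thesis by (simp add: part_hom_def)
qed


section \<open>Recognising vertices and edges in the path partial group\<close>

abbreviation Z2 :: "int monoid" where "Z2 \<equiv> integer_mod_group 2"

lemma letters_Z2: "letters (\<lambda>_. Z2) C = C \<times> {1}"
  by (auto simp: letters_def carrier_integer_mod_group)

lemma carrier_path: "carrier (path_partial_group G) = (\<Union>C\<in>{C. clique G C}. CR (\<lambda>_. Z2) C)"
  unfolding path_partial_group_def by (rule carrier_graph)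

lemma vertex_carrier_iff: "[(v, 1)] \<in> carrier (path_partial_group G) \<longleftrightarrow> v \<in> pverts G"
proof
  assume "v \<in> pverts G"
  then have "clique G {v}" "[(v, 1)] \<in> CR (\<lambda>_. Z2) {v}"
    by (auto simp: clique_def CR_def letters_Z2 cyclically_reduced_altdef)
  then show "[(v, 1)] \<in> carrier (path_partial_group G)" by (auto simp: carrier_path)
qed (auto simp: carrier_path clique_def CR_def letters_Z2)

lemma Nil_pdom: "[] \<in> pdom (path_partial_group G)"
  and pprod_Nil: "pprod (path_partial_group G) [] = []"
proof -
  have "clique G {}" by (simp add: clique_def)
  moreover have "[] \<in> pdom (clique_partial_group H {})" for H :: "'a \<Rightarrow> int monoid"
    by (simp add: clique_partial_group_def)
  ultimately show "[] \<in> pdom (path_partial_group G)"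
    by (auto simp: path_partial_group_def pdom_graph_iff)
  show "pprod (path_partial_group G) [] = []"
    by (simp add: path_partial_group_def pprod_graph[where C = "{}"])
qed

lemma pair_pdom:
  assumes "clique G C" "x \<in> CR (\<lambda>_. Z2) C" "y \<in> CR (\<lambda>_. Z2) C"
    "nf (\<lambda>_. Z2) (x @ y) \<in> CR (\<lambda>_. Z2) C"
  shows "[x, y] \<in> pdom (path_partial_group G)"
    "pprod (path_partial_group G) [x, y] = nf (\<lambda>_. Z2) (x @ y)"
proof -
  interpret group_family "\<lambda>_. Z2" C by (rule group_family.intro) simp
  have "[x, y] \<in> pdom (clique_partial_group (\<lambda>_. Z2) C)"
    using assms nf_CR unfolding pdom_clique_iff
    by (auto simp: Cons_eq_append_conv append_eq_Cons_conv)
  with assms(1) show "[x, y] \<in> pdom (path_partial_group G)"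
    by (auto simp: path_partial_group_def pdom_graph_iff)
  show "pprod (path_partial_group G) [x, y] = nf (\<lambda>_. Z2) (x @ y)"
    using assms by (simp add: path_partial_group_def pprod_graph[where C = C])
qed

lemma pair_pdomD:
  assumes "[x, y] \<in> pdom (path_partial_group G)"
  obtains C where "clique G C" "x \<in> CR (\<lambda>_. Z2) C" "y \<in> CR (\<lambda>_. Z2) C"
    "pprod (path_partial_group G) [x, y] = nf (\<lambda>_. Z2) (x @ y)"
proof -
  obtain C where C: "clique G C" "[x, y] \<in> lists (CR (\<lambda>_. Z2) C)"
    using assms by (auto simp: path_partial_group_def pdom_graph_iff dest!: pdom_clique_lists)
  from that[of C] C show ?thesis
    by (simp add: path_partial_group_def pprod_graph[where C = C])
qed

text \<open>
  In a free product of groups of order 2 the involutions are the conjugates of the letters; among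
  these only the letters themselves are cyclically reduced. Here this follows at once from the fact
  that the square of a longer cyclically reduced word is already reduced.
\<close>

lemma pprod_square_eq_Nil_iff:
  assumes "x \<noteq> []"
  shows "[x, x] \<in> pdom (path_partial_group G) \<and> pprod (path_partial_group G) [x, x] = []
    \<longleftrightarrow> (\<exists>v\<in>pverts G. x = [(v, 1)])"
proof
  assume *: "[x, x] \<in> pdom (path_partial_group G) \<and> pprod (path_partial_group G) [x, x] = []"
  then obtain C where C: "clique G C" "x \<in> CR (\<lambda>_. Z2) C" "nf (\<lambda>_. Z2) (x @ x) = []"
    using pair_pdomD by metis
  have "length x < 2"
  proof (rule ccontr)
    assume "\<not> length x < 2"
    then have "reduced (x @ x)" using C(2) by (intro cyclically_reduced_square) (simp_all add: CR_def)
    with C(3) show False using nf_reduced[of "x @ x" "\<lambda>_. Z2"] assms by simp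
  qed
  then have "length x = 1" using assms by (cases x) auto
  then obtain a where "x = [a]" by (auto simp: length_Suc_conv)
  then show "\<exists>v\<in>pverts G. x = [(v, 1)]" using C by (auto simp: CR_def letters_Z2 clique_def)
next
  assume "\<exists>v\<in>pverts G. x = [(v, 1)]"
  then obtain v where v: "v \<in> pverts G" "x = [(v, 1)]" by blast
  have nf: "nf (\<lambda>_. Z2) (x @ x) = []" by (simp add: v mult_integer_mod_group)
  have "clique G {v}" "x \<in> CR (\<lambda>_. Z2) {v}" "[] \<in> CR (\<lambda>_. Z2) {v}"
    using v by (auto simp: clique_def CR_def letters_Z2 cyclically_reduced_altdef)
  then show "[x, x] \<in> pdom (path_partial_group G) \<and> pprod (path_partial_group G) [x, x] = []"
    using pair_pdom[of G "{v}" x x] nf by simp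
qed

lemma vertex_pair_pdom_iff:
  assumes "pair_bidirected_digraph G" "u \<noteq> v"
  shows "[[(u, 1)], [(v, 1)]] \<in> pdom (path_partial_group G) \<longleftrightarrow> (u, v) \<in> parcs G"
proof
  interpret pair_bidirected_digraph G by fact
  assume uv: "(u, v) \<in> parcs G"
  then have "clique G {u, v}" using arcs_symmetric[OF uv] wellformed'[OF uv] by (auto simp: clique_def)
  then show "[[(u, 1)], [(v, 1)]] \<in> pdom (path_partial_group G)"
    using assms(2)
    by (intro pair_pdom[of G "{u, v}"]) (auto simp: CR_def letters_Z2 cyclically_reduced_altdef)
next
  assume "[[(u, 1)], [(v, 1)]] \<in> pdom (path_partial_group G)"
  then show "(u, v) \<in> parcs G"
    using assms(2) by (elim pair_pdomD) (auto simp: CR_def letters_Z2 clique_def)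
qed

section \<open>Injective homomorphisms are letterwise\<close>

text \<open>
  Injectivity ensures that vertices are not mapped to the unit and that adjacent vertices remain
  distinct; the values on vertices then determine those on longer words.
\<close>

theorem inj_part_hom_eq_relabel:
  assumes G: "pair_bidirected_digraph G" and K: "pair_bidirected_digraph K"
    and phi: "\<phi> \<in> part_hom (path_partial_group G) (path_partial_group K)"
    and inj: "inj_on \<phi> (carrier (path_partial_group G))"
  obtains f where "f \<in> graph_hom G K"
    "\<And>x. x \<in> carrier (path_partial_group G) \<Longrightarrow> \<phi> x = relabel f x"
proof -
  let ?M = "path_partial_group G" and ?N = "path_partial_group K"
  have hom: "map \<phi> us \<in> pdom ?N" "pprod ?N (map \<phi> us) = \<phi> (pprod ?M us)" if "us \<in> pdom ?M" for us
    using phi that by (auto simp: part_hom_def)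
  have Nil: "\<phi> [] = []" using hom[OF Nil_pdom] by (simp add: pprod_Nil)
  have Nil_M: "[] \<in> carrier ?M"
    using partial_group.pprod_closed[OF partial_group_path Nil_pdom] by (simp add: pprod_Nil)
  have "\<exists>v'\<in>pverts K. \<phi> [(v, 1)] = [(v', 1)]" if v: "v \<in> pverts G" for v
  proof -
    have "[[(v, 1)], [(v, 1)]] \<in> pdom ?M" "pprod ?M [[(v, 1)], [(v, 1)]] = []"
      using pprod_square_eq_Nil_iff[of "[(v, 1)]" G] v by auto
    from hom[OF this(1)] this(2) Nil have "[\<phi> [(v, 1)], \<phi> [(v, 1)]] \<in> pdom ?N"
      "pprod ?N [\<phi> [(v, 1)], \<phi> [(v, 1)]] = []" by simp_all
    moreover have "\<phi> [(v, 1)] \<noteq> []"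
      using inj_onD[OF inj, of "[(v, 1)]" "[]"] Nil Nil_M v by (auto simp: vertex_carrier_iff)
    ultimately show ?thesis using pprod_square_eq_Nil_iff by blast
  qed
  then obtain f where f: "f v \<in> pverts K" "\<phi> [(v, 1)] = [(f v, 1)]" if "v \<in> pverts G" for v
    by metis
  have "(f u, f v) \<in> parcs K" if uv: "(u, v) \<in> parcs G" for u v
  proof -
    interpret G: pair_bidirected_digraph G by fact
    have V: "u \<in> pverts G" "v \<in> pverts G" "u \<noteq> v"
      using uv G.wellformed' G.no_loops' by blast+
    have "\<phi> [(u, 1)] \<noteq> \<phi> [(v, 1)]"
      using inj_onD[OF inj, of "[(u, 1)]" "[(v, 1)]"] V by (auto simp: vertex_carrier_iff)
    then have "f u \<noteq> f v" using f V by auto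
    then show ?thesis
      using hom(1)[of "[[(u, 1)], [(v, 1)]]"] uv V f
        vertex_pair_pdom_iff[OF G V(3)] vertex_pair_pdom_iff[OF K] by simp
  qed
  then have f_hom: "f \<in> graph_hom G K" using f by (auto simp: graph_hom_def)
  \<comment> \<open>A longer word is a product of two shorter ones, and both \<open>\<phi>\<close> and the letterwise action of
    \<open>f\<close> preserve this product.\<close>
  have "\<phi> w = relabel f w" if "clique G C" "w \<in> CR (\<lambda>_. Z2) C" for C w
    using that(2)
  proof (induction w rule: length_induct)
    case (1 w)
    show ?case
    proof (cases "length w \<ge> 2")
      case True
      obtain x y where xy: "w = x @ y" "x \<noteq> []" "y \<noteq> []"
          "cyclically_reduced x" "cyclically_reduced y"
        using cyclically_reduced_split[OF _ True] 1(2) by (auto simp: CR_def)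
      then have CR: "x \<in> CR (\<lambda>_. Z2) C" "y \<in> CR (\<lambda>_. Z2) C"
        using 1(2) by (auto simp: CR_def)
      then have IH: "\<phi> x = relabel f x" "\<phi> y = relabel f y" using 1(1) xy by auto
      interpret group_family "\<lambda>_. Z2" C by (rule group_family.intro) simp
      have nf: "nf (\<lambda>_. Z2) (x @ y) = w" using nf_CR[OF 1(2)] xy by simp
      note pair = pair_pdom[OF \<open>clique G C\<close> CR, unfolded nf, OF 1(2)]
      have "\<phi> w = pprod ?N [relabel f x, relabel f y]"
        using hom(2)[OF pair(1)] pair(2) IH by simp
      also have "\<dots> = relabel f w"
        using part_hom_relabel[OF K, of Z2 f G] f_hom pair
        by (auto simp: part_hom_def path_partial_group_def)
      finally show ?thesis .
    next
      case False
      then consider "w = []" | a where "w = [a]" by (cases w rule: remdups_adj.cases) auto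
      then show ?thesis
        using 1(2) \<open>clique G C\<close> f(2) Nil by cases (auto simp: CR_def letters_Z2 clique_def)
    qed
  qed
  then show ?thesis using that[OF f_hom] by (auto simp: carrier_path)
qed


section \<open>Automorphism groups\<close>

text \<open>The restriction makes the action an extensional function, as the elements of
  \<^const>\<open>Bij\<close> have to be.\<close>

definition relabel_aut :: "'v pair_pre_digraph \<Rightarrow> ('v \<Rightarrow> 'v) \<Rightarrow> ('v \<times> int) list \<Rightarrow> ('v \<times> int) list"
  where "relabel_aut G f = (\<lambda>x\<in>carrier (path_partial_group G). relabel f x)"

text \<open>The definition of an isomorphism refers to \<^const>\<open>inv_into\<close>. The following two rules allow
  an inverse homomorphism to be given as any function that is correct on the carrier.\<close>

lemma graph_autI:
  assumes "f \<in> graph_hom G G" "g \<in> graph_hom G G" "f \<in> extensional (pverts G)"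
    and "pair_wf_digraph G"
    and "\<And>v. v \<in> pverts G \<Longrightarrow> g (f v) = v" "\<And>v. v \<in> pverts G \<Longrightarrow> f (g v) = v"
  shows "f \<in> carrier (Aut_Graphs G)"
proof -
  have V: "f v \<in> pverts G" "g v \<in> pverts G" if "v \<in> pverts G" for v
    using assms(1,2) that by (auto simp: graph_hom_def)
  have bij: "bij_betw f (pverts G) (pverts G)"
    by (rule bij_betw_byWitness[where f' = g]) (use V assms(5,6) in auto)
  have "inv_into (pverts G) f v = g v" if "v \<in> pverts G" for v
    by (rule inv_into_f_eq) (use bij V assms(6) that in \<open>auto simp: bij_betw_def\<close>)
  then have "inv_into (pverts G) f \<in> graph_hom G G"
    using graph_hom_cong[OF assms(4,2)] by simp
  then show ?thesis using assms(1,3) bij by (simp add: Aut_Graphs_def graph_iso_def Bij_def)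
qed

lemma (in partial_group) part_autI:
  assumes "f \<in> part_hom M M" "g \<in> part_hom M M" "f \<in> extensional (carrier M)"
    and "\<And>x. x \<in> carrier M \<Longrightarrow> g (f x) = x" "\<And>x. x \<in> carrier M \<Longrightarrow> f (g x) = x"
  shows "f \<in> carrier (Aut_Part M)"
proof -
  have V: "f x \<in> carrier M" "g x \<in> carrier M" if "x \<in> carrier M" for x
    using assms(1,2) that by (auto simp: part_hom_def)
  have bij: "bij_betw f (carrier M) (carrier M)"
    by (rule bij_betw_byWitness[where f' = g]) (use V assms(4,5) in auto)
  have "inv_into (carrier M) f x = g x" if "x \<in> carrier M" for x
    by (rule inv_into_f_eq) (use bij V assms(5) that in \<open>auto simp: bij_betw_def\<close>)
  then have "inv_into (carrier M) f \<in> part_hom M M"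
    using part_hom_cong[OF assms(2)] by simp
  then show ?thesis using assms(1,3) bij by (simp add: Aut_Part_def part_iso_def Bij_def)
qed

lemma relabel_idI:
  assumes "x \<in> carrier (path_partial_group G)" "\<And>v. v \<in> pverts G \<Longrightarrow> f v = v"
  shows "relabel f x = x"
  using assms unfolding relabel_def
  by (intro map_idI prod_eqI) (auto simp: carrier_path CR_def letters_Z2 clique_def subset_iff)

lemma relabel_aut_vertex: "v \<in> pverts G \<Longrightarrow> relabel_aut G f [(v, 1)] = [(f v, 1)]"
  by (simp add: relabel_aut_def vertex_carrier_iff)

lemma relabel_aut_closed:
  assumes "pair_bidirected_digraph G" "f \<in> carrier (Aut_Graphs G)"
  shows "relabel_aut G f \<in> carrier (Aut_Part (path_partial_group G))"
proof -
  let ?V = "pverts G" and ?M = "path_partial_group G"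
  interpret partial_group ?M by (rule partial_group_path)
  define g where "g = inv_into ?V f"
  have f: "f \<in> graph_hom G G" "bij_betw f ?V ?V" and g: "g \<in> graph_hom G G"
    using assms(2) by (auto simp: Aut_Graphs_def graph_iso_def g_def)
  have hom: "relabel h \<in> part_hom ?M ?M" if "h \<in> graph_hom G G" for h
    using part_hom_relabel[OF assms(1) _ that, of Z2] by (simp add: path_partial_group_def)
  have closed: "relabel h x \<in> carrier ?M" if "h \<in> graph_hom G G" "x \<in> carrier ?M" for h x
    using hom[OF that(1)] that(2) by (auto simp: part_hom_def)
  have gf: "g (f v) = v" "f (g v) = v" if "v \<in> ?V" for v
    using f(2) that by (auto simp: g_def bij_betw_def f_inv_into_f)
  show ?thesis
  proof (rule part_autI)
    show "relabel_aut G f \<in> part_hom ?M ?M"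
      by (rule part_hom_cong[OF hom[OF f(1)]]) (simp add: relabel_aut_def)
    show "relabel g \<in> part_hom ?M ?M" by (rule hom[OF g])
    show "relabel_aut G f \<in> extensional (carrier ?M)" by (simp add: relabel_aut_def)
    show "relabel g (relabel_aut G f x) = x" "relabel_aut G f (relabel g x) = x"
      if "x \<in> carrier ?M" for x
      using that closed[OF g that] relabel_idI[OF that] gf
      by (simp_all add: relabel_aut_def relabel_relabel)
  qed
qed

text \<open>An automorphism and its inverse are both letterwise, by graph homomorphisms that are inverse
  to each other because the vertices are themselves words.\<close>

lemma relabel_aut_surj:
  assumes "pair_bidirected_digraph G" "\<phi> \<in> carrier (Aut_Part (path_partial_group G))"
  shows "\<exists>f\<in>carrier (Aut_Graphs G). relabel_aut G f = \<phi>"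
proof -
  let ?V = "pverts G" and ?M = "path_partial_group G"
  interpret pair_bidirected_digraph G by fact
  have wf: "pair_wf_digraph G" by unfold_locales
  define \<psi> where "\<psi> = inv_into (carrier ?M) \<phi>"
  have phi: "\<phi> \<in> part_hom ?M ?M" "bij_betw \<phi> (carrier ?M) (carrier ?M)"
      "\<phi> \<in> extensional (carrier ?M)" and psi: "\<psi> \<in> part_hom ?M ?M"
    using assms(2) by (auto simp: Aut_Part_def part_iso_def Bij_def \<psi>_def)
  have "bij_betw \<psi> (carrier ?M) (carrier ?M)"
    unfolding \<psi>_def by (rule bij_betw_inv_into[OF phi(2)])
  then obtain f g where f: "f \<in> graph_hom G G" "\<And>x. x \<in> carrier ?M \<Longrightarrow> \<phi> x = relabel f x"
    and g: "g \<in> graph_hom G G" "\<And>x. x \<in> carrier ?M \<Longrightarrow> \<psi> x = relabel g x"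
    using inj_part_hom_eq_relabel[OF assms(1,1)] phi psi bij_betw_imp_inj_on by metis
  have V: "f v \<in> ?V" "g v \<in> ?V" if "v \<in> ?V" for v
    using f(1) g(1) that by (auto simp: graph_hom_def)
  have gf: "g (f v) = v" "f (g v) = v" if v: "v \<in> ?V" for v
  proof -
    have "\<psi> (\<phi> [(v, 1)]) = [(v, 1)]" "\<phi> (\<psi> [(v, 1)]) = [(v, 1)]"
      using phi(2) v by (auto simp: \<psi>_def vertex_carrier_iff bij_betw_def f_inv_into_f)
    then show "g (f v) = v" "f (g v) = v"
      using v V f(2) g(2) by (simp_all add: vertex_carrier_iff)
  qed
  let ?f = "restrict f ?V"
  have "?f \<in> graph_hom G G" by (rule graph_hom_cong[OF wf f(1)]) simp
  then have "?f \<in> carrier (Aut_Graphs G)"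
    by (rule graph_autI[OF _ g(1)]) (use wf gf V in simp_all)
  moreover have "relabel_aut G ?f x = \<phi> x" for x
  proof (cases "x \<in> carrier ?M")
    case True
    then have "relabel ?f x = relabel f x"
      unfolding relabel_def
      by (intro map_cong refl prod_eqI) (auto simp: carrier_path CR_def letters_Z2 clique_def subset_iff)
    then show ?thesis using True f(2) by (simp add: relabel_aut_def)
  qed (use phi(3) in \<open>simp add: relabel_aut_def extensional_def\<close>)
  ultimately show ?thesis by blast
qed

lemma relabel_aut_compose:
  assumes "pair_bidirected_digraph G" "g \<in> carrier (Aut_Graphs G)"
  shows "relabel_aut G (compose (pverts G) f g) =
    compose (carrier (path_partial_group G)) (relabel_aut G f) (relabel_aut G g)"
proof
  fix x
  show "relabel_aut G (compose (pverts G) f g) x =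
    compose (carrier (path_partial_group G)) (relabel_aut G f) (relabel_aut G g) x"
  proof (cases "x \<in> carrier (path_partial_group G)")
    case True
    have "relabel_aut G g \<in> carrier (Aut_Part (path_partial_group G))"
      by (rule relabel_aut_closed[OF assms])
    then have "relabel_aut G g x \<in> carrier (path_partial_group G)"
      using True by (auto simp: Aut_Part_def dest: Bij_imp_funcset)
    moreover have "relabel (compose (pverts G) f g) x = relabel (\<lambda>v. f (g v)) x"
      unfolding relabel_def using True
      by (intro map_cong refl prod_eqI)
        (auto simp: carrier_path CR_def letters_Z2 clique_def subset_iff compose_def)
    ultimately show ?thesis
      using True by (simp add: relabel_aut_def compose_def relabel_relabel)
  qed (simp add: relabel_aut_def compose_def)
qed

lemma inj_relabel_aut: "inj_on (relabel_aut G) (carrier (Aut_Graphs G))"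
proof (rule inj_onI)
  fix f g assume fg: "f \<in> carrier (Aut_Graphs G)" "g \<in> carrier (Aut_Graphs G)"
    and eq: "relabel_aut G f = relabel_aut G g"
  have "f v = g v" if "v \<in> pverts G" for v
    using relabel_aut_vertex[OF that, of f] relabel_aut_vertex[OF that, of g] eq by simp
  then show "f = g"
    using fg by (intro extensionalityI[of f "pverts G" g]) (auto simp: Aut_Graphs_def Bij_def)
qed

theorem theorem3:
  fixes G :: "'v pair_pre_digraph"
  assumes "pair_bidirected_digraph G"
  shows "Aut_Part (path_partial_group G) \<cong> Aut_Graphs G"
proof -
  interpret pair_bidirected_digraph G by fact
  have "group (Aut_Graphs G)" by (rule group_Aut_Graphs) unfold_locales
  moreover have "relabel_aut G \<in> iso (Aut_Graphs G) (Aut_Part (path_partial_group G))"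
  proof (rule isoI)
    note closed = relabel_aut_closed[OF assms]
    show "relabel_aut G \<in> hom (Aut_Graphs G) (Aut_Part (path_partial_group G))"
    proof (rule homI)
      fix f g assume fg: "f \<in> carrier (Aut_Graphs G)" "g \<in> carrier (Aut_Graphs G)"
      then have "f \<in> Bij (pverts G)" "g \<in> Bij (pverts G)"
        by (auto simp: Aut_Graphs_def)
      moreover have "relabel_aut G f \<in> Bij (carrier (path_partial_group G))"
        "relabel_aut G g \<in> Bij (carrier (path_partial_group G))"
        using fg[THEN closed] by (auto simp: Aut_Part_def)
      ultimately show "relabel_aut G (f \<otimes>\<^bsub>Aut_Graphs G\<^esub> g) =
          relabel_aut G f \<otimes>\<^bsub>Aut_Part (path_partial_group G)\<^esub> relabel_aut G g"
        using relabel_aut_compose[OF assms fg(2), of f]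
        by (simp add: Aut_Graphs_def Aut_Part_def BijGroup_def)
    qed (rule closed)
    show "bij_betw (relabel_aut G) (carrier (Aut_Graphs G))
        (carrier (Aut_Part (path_partial_group G)))"
      using inj_relabel_aut closed relabel_aut_surj[OF assms]
      by (auto simp: bij_betw_def image_iff Bex_def) blast
  qed
  ultimately have "Aut_Graphs G \<cong> Aut_Part (path_partial_group G)"
    by (auto simp: is_iso_def)
  with \<open>group (Aut_Graphs G)\<close> show ?thesis by (rule group.iso_sym)
qed

end
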